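(* Let $\mu$ be a discrete probability measure on $[0,1]$. For $N\in\mathbb{N}$ and points $y_1,\dots,y_N\in[0,1]$ let $\nu_N=\frac1N\sum_{k=1}^N\delta_{y_k}$. \begin{itemize} \item[(i)] (Finitely supported, rational weights.) Suppose $\mu=\sum_{i=1}^n \xi_i\delta_{x_i}$ with $0\le x_1<x_2<\dots<x_n\le 1$, where $\xi_i=\frac{p_i}{q_i}$ with $p_i,q_i\in\mathbb{N}$ and $\gcd(p_i,q_i)=1$. If $\operatorname{lcm}(q_1,\dots,q_{n-1})$ divides $N$, then there exists a point set $(y_k)_{k=1}^N$ with $D_N^*(\mu,\nu_N)=0$. Otherwise $D_N^*(\mu,\nu_N)\ge \frac{1}{qN}$ for all point sets $(y_k)_{k=1}^N$, where $q=\max(q_1,\dots,q_n)$. \item[(ii)] (Finitely supported, irrational weights.) Suppose $\mu=\sum_{i=1}^n \xi_i\delta_{x_i}$ with $0\le x_1<x_2<\dots<x_n\le 1$, $\xi_i\notin\mathbb{Q}$ for all $i$, and $\sum_{i=1}^l\xi_i\notin\mathbb{Q}$ for all $l=1,\dots,n-1$. Then for every $c>2$ there exist infinitely many $N\in\mathbb{N}$ such that $D_N^*(\mu,\nu_N)\ge\frac{1}{cN}$ for every point set $(y_k)_{k=1}^N$. \item[(iii)] (Infinitely supported.) Suppose $\mu=\sum_{i=1}^\infty \xi_i\delta_{x_i}$ with $x_i<x_{i+1}$ and $\xi_i>0$ for all $i\in\mathbb{N}$. Then there exists a constant $c\ge 2$ such that for infinitely many $N$, $D_N^*(\mu,\nu_N)\ge\frac{1}{cN}$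 holds for every point set $(y_k)_{k=1}^N$. If in addition $\sum_{i=1}^l\xi_i\notin\mathbb{Q}$ for all $l\in\mathbb{N}$, then $c>2$ can be chosen arbitrarily. \end{itemize}
   Context: For probability measures $\mu,\nu$ on $[0,1]$, the star-discrepancy is $D_N^*(\mu,\nu)=\sup_{A\in\mathcal{A}}|\mu(A)-\nu(A)|$, where $\mathcal{A}$ is the set of all half-open intervals in $[0,1]$ having one vertex at the origin (i.e. intervals $[0,a)$). $\delta_x$ denotes the Dirac measure at $x$. A discrete measure is one vanishing on the complement of a countable set. *)

theory Defs
  imports "HOL-Probability.Probability"
begin

abbreviation unit_borel :: "real measure" where
  "unit_borel \<equiv> restrict_space borel {0..1}"

definition discrete_measure :: "'a measure \<Rightarrow> bool" where
  "discrete_measure \<mu> \<longleftrightarrow>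
     (\<exists>C. countable C \<and> C \<in> sets \<mu> \<and> emeasure \<mu> (space \<mu> - C) = 0)"

text \<open>
  \<open>is_dirac_sum \<mu> I \<xi> x\<close> says that \<open>\<mu>\<close> is the sum of the measures
  \<open>\<xi>\<^sub>i \<delta>\<^bsub>x\<^sub>i\<^esub>\<close> over \<open>i \<in> I\<close>.
  The equation is stated setwise and with real values, so that it forces the weights at
  distinct points to be nonnegative; \<^const>\<open>ennreal\<close> would truncate negative weights to 0.
  For finite \<open>I\<close>, \<^const>\<open>has_sum\<close> is the ordinary finite sum.
\<close>
definition is_dirac_sum ::
    "real measure \<Rightarrow> nat set \<Rightarrow> (nat \<Rightarrow> real) \<Rightarrow> (nat \<Rightarrow> real) \<Rightarrow> bool" where
  "is_dirac_sum \<mu> I \<xi> x \<longleftrightarrow>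
     (\<forall>A\<in>sets \<mu>. ((\<lambda>i. \<xi> i * measure (return unit_borel (x i)) A) has_sum measure \<mu> A) I)"

definition empirical_measure :: "nat \<Rightarrow> (nat \<Rightarrow> real) \<Rightarrow> real measure" where
  "empirical_measure N y =
     measure_of {0..1} (sets unit_borel)
       (\<lambda>A. ennreal (1 / real N) * (\<Sum>k=1..N. emeasure (return unit_borel (y k)) A))"

definition anchored_intervals :: "real set set" where
  "anchored_intervals = {{0..<a} | a. 0 \<le> a \<and> a \<le> 1}"

definition star_discrepancy :: "real measure \<Rightarrow> real measure \<Rightarrow> real" where
  "star_discrepancy \<mu> \<nu> = (SUP A\<in>anchored_intervals. \<bar>measure \<mu> A - measure \<nu> A\<bar>)"

definition point_set :: "nat \<Rightarrow> (nat \<Rightarrow> real) \<Rightarrow> bool" where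
  "point_set N y \<longleftrightarrow> (\<forall>k\<in>{1..N}. y k \<in> {0..1})"

lemma sets_empirical_measure [simp]: "sets (empirical_measure N y) = sets unit_borel"
  and space_empirical_measure [simp]: "space (empirical_measure N y) = {0..1}"
proof -
  have "sets unit_borel \<subseteq> Pow {0..1}" "sigma_sets {0..1} (sets unit_borel) = sets unit_borel"
    using sets.space_closed[of unit_borel] sets.sigma_sets_eq[of unit_borel]
    by (simp_all add: space_restrict_space)
  then show "sets (empirical_measure N y) = sets unit_borel"
    "space (empirical_measure N y) = {0..1}"
    unfolding empirical_measure_def by (simp_all add: sets_measure_of space_measure_of)
qed

lemma emeasure_empirical_measure:
  assumes A: "A \<in> sets unit_borel"
  shows "emeasure (empirical_measure N y) A =
    ennreal (1 / real N) * (\<Sum>k=1..N. emeasure (return unit_borel (y k)) A)"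
proof (rule emeasure_measure_of[OF empirical_measure_def])
  show "sets unit_borel \<subseteq> Pow {0..1}"
    using sets.space_closed[of unit_borel] by (simp add: space_restrict_space)
  show "A \<in> sets (empirical_measure N y)" using A by simp
  show "positive (sets (empirical_measure N y))
     (\<lambda>A. ennreal (1 / real N) * (\<Sum>k=1..N. emeasure (return unit_borel (y k)) A))"
    by (simp add: positive_def)
  show "countably_additive (sets (empirical_measure N y))
     (\<lambda>A. ennreal (1 / real N) * (\<Sum>k=1..N. emeasure (return unit_borel (y k)) A))"
  proof (rule countably_additiveI)
    fix B :: "nat \<Rightarrow> real set"
    assume B: "range B \<subseteq> sets (empirical_measure N y)" "disjoint_family B"
    have "(\<Sum>i. emeasure (return unit_borel (y k)) (B i)) =
      emeasure (return unit_borel (y k)) (\<Union>i. B i)" for k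
      by (rule suminf_emeasure) (use B in auto)
    then show "(\<Sum>i. ennreal (1 / real N) *
        (\<Sum>k=1..N. emeasure (return unit_borel (y k)) (B i))) =
      ennreal (1 / real N) * (\<Sum>k=1..N. emeasure (return unit_borel (y k)) (\<Union>i. B i))"
      by (simp add: suminf_sum)
  qed
qed

end

theory Submission
  imports Defs "HOL-Analysis.Kronecker_Approximation_Theorem"
begin

text \<open>
  The empirical measure gives every interval a mass in \<open>\<int> / N\<close>, so the discrepancy is at least
  the distance of \<open>\<mu> [0, a)\<close> to \<open>\<int> / N\<close>.  Choosing for \<open>a\<close> the next atom makes \<open>\<mu> [0, a)\<close> a
  partial sum of the weights.  For rational weights take the partial sum up to the first \<open>i\<close> with
  \<open>q\<^sub>i\<close> not dividing \<open>N\<close>; for an irrational first weight \<open>\<xi>\<^sub>1\<close>, Kronecker's theorem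
  brings \<open>N \<xi>\<^sub>1\<close> as close to a half-integer as desired for infinitely many \<open>N\<close>.
  In (iii), a rational \<open>\<xi>\<^sub>1 \<in> (0, 1)\<close> with denominator \<open>q\<close> leaves the bound \<open>1 / (q N)\<close> for
  every \<open>N\<close> congruent to 1 modulo \<open>q\<close>.
\<close>

section \<open>Masses of Dirac sums and of empirical measures\<close>

lemma anchored_interval_in_sets:
  "a \<le> 1 \<Longrightarrow> {0..<a} \<in> sets unit_borel"
  by (auto simp: sets_restrict_space_iff)

lemma measure_return_unit_borel:
  "A \<in> sets unit_borel \<Longrightarrow> measure (return unit_borel x) A = indicator A x"
  by (simp add: measure_def emeasure_return del: sets_restrict_space_iff split: split_indicator)

text \<open>The Dirac factor is 1 on \<open>J\<close> and 0 on the rest of \<open>I\<close>, so the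
  sum collapses to the finite set \<open>J\<close> even when \<open>I\<close> is infinite. Every
  mass of \<mu> below is evaluated this way.\<close>

lemma is_dirac_sum_measure_eq:
  assumes "is_dirac_sum \<mu> I \<xi> x" "sets \<mu> = sets unit_borel" "A \<in> sets unit_borel"
    and "finite J" "J \<subseteq> I" "\<And>i. i \<in> I \<Longrightarrow> x i \<in> A \<longleftrightarrow> i \<in> J"
  shows "measure \<mu> A = sum \<xi> J"
proof -
  have "((\<lambda>i. \<xi> i * measure (return unit_borel (x i)) A) has_sum measure \<mu> A) I"
    using assms(1-3) unfolding is_dirac_sum_def by auto
  moreover have "((\<lambda>i. \<xi> i * measure (return unit_borel (x i)) A) has_sum measure \<mu> A) I
      \<longleftrightarrow> (\<xi> has_sum measure \<mu> A) J"
    using assms(3,5,6) by (intro has_sum_cong_neutral) (auto simp: measure_return_unit_borel)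
  moreover have "(\<xi> has_sum sum \<xi> J) J"
    using assms(4) by (rule has_sum_finite)
  ultimately show ?thesis
    using has_sum_unique by blast
qed

lemma is_dirac_sum_weights_sum:
  assumes "prob_space \<mu>" "sets \<mu> = sets unit_borel" "is_dirac_sum \<mu> I \<xi> x"
    and "finite I" "\<forall>i\<in>I. 0 \<le> x i \<and> x i \<le> 1"
  shows "sum \<xi> I = 1"
proof -
  have "space \<mu> = {0..1}"
    using sets_eq_imp_space_eq[OF assms(2)] by (simp add: space_restrict_space)
  moreover have "measure \<mu> {0..1} = sum \<xi> I"
    using assms(4,5) by (intro is_dirac_sum_measure_eq[OF assms(3,2)])
      (auto simp: sets_restrict_space_iff)
  ultimately show ?thesis
    using prob_space.prob_space[OF assms(1)] by simp
qed

lemma measure_empirical_measure: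
  assumes "N \<ge> 1" "A \<in> sets unit_borel"
  shows "measure (empirical_measure N y) A = real (card {k\<in>{1..N}. y k \<in> A}) / real N"
proof -
  have "(\<Sum>k=1..N. emeasure (return unit_borel (y k)) A) = (\<Sum>k=1..N. indicator A (y k))"
    using assms(2) by (intro sum.cong) (auto simp: emeasure_return)
  also have "\<dots> = (\<Sum>k\<in>{k\<in>{1..N}. y k \<in> A}. 1)"
    by (intro sum.mono_neutral_cong_right) auto
  also have "\<dots> = ennreal (real (card {k\<in>{1..N}. y k \<in> A}))"
    by (simp add: ennreal_of_nat_eq_real_of_nat)
  finally have "emeasure (empirical_measure N y) A =
      ennreal (1 / real N * real (card {k\<in>{1..N}. y k \<in> A}))"
    using assms(2) by (simp only: emeasure_empirical_measure) (subst ennreal_mult, simp_all)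
  then show ?thesis
    by (simp add: measure_def)
qed

section \<open>Lower bounds from the distance to the integers\<close>

text \<open>If \<open>m\<close> of the \<open>N\<close> points lie in [0, a), then \<open>N\<close>
  times the deviation on this interval is the distance from N \<mu>[0, a) to the integer
  \<open>m\<close>. A bound over all integers is therefore uniform in the point set.\<close>

lemma star_discrepancy_ge:
  assumes "prob_space \<mu>" "N \<ge> 1" "0 \<le> a" "a \<le> 1"
    and dist: "\<And>k::int. d \<le> \<bar>real N * measure \<mu> {0..<a} - of_int k\<bar>"
  shows "d / real N \<le> star_discrepancy \<mu> (empirical_measure N y)"
proof -
  interpret prob_space \<mu> by fact
  let ?\<nu> = "empirical_measure N y"
  \<comment> \<open>A real supremum is known to dominate its members only for a family bounded
    above; here both masses lie in [0, 1].\<close>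
  have "bdd_above ((\<lambda>A. \<bar>measure \<mu> A - measure ?\<nu> A\<bar>) ` anchored_intervals)"
  proof (rule bdd_aboveI2[where M = 1])
    fix A assume "A \<in> anchored_intervals"
    then have A: "A \<in> sets unit_borel"
      unfolding anchored_intervals_def using anchored_interval_in_sets by blast
    have "card {k\<in>{1..N}. y k \<in> A} \<le> card {1..N}"
      by (intro card_mono) auto
    then have "measure ?\<nu> A \<le> 1"
      using assms(2) by (simp add: measure_empirical_measure[OF _ A])
    moreover have "measure ?\<nu> A \<ge> 0" "measure \<mu> A \<ge> 0" "measure \<mu> A \<le> 1"
      by simp_all
    ultimately show "\<bar>measure \<mu> A - measure ?\<nu> A\<bar> \<le> 1"
      by linarith
  qed
  moreover have "{0..<a} \<in> anchored_intervals"
    unfolding anchored_intervals_def using assms by auto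
  ultimately have "\<bar>measure \<mu> {0..<a} - measure ?\<nu> {0..<a}\<bar> \<le> star_discrepancy \<mu> ?\<nu>"
    unfolding star_discrepancy_def by (rule cSUP_upper[rotated])
  moreover define m where "m = card {k\<in>{1..N}. y k \<in> {0..<a}}"
  have "\<bar>measure \<mu> {0..<a} - measure ?\<nu> {0..<a}\<bar> = \<bar>measure \<mu> {0..<a} - real m / real N\<bar>"
    unfolding m_def using assms by (simp add: measure_empirical_measure anchored_interval_in_sets)
  moreover have "\<bar>measure \<mu> {0..<a} - real m / real N\<bar>
      = \<bar>real N * measure \<mu> {0..<a} - real m\<bar> / real N"
  proof -
    have "measure \<mu> {0..<a} - real m / real N = (real N * measure \<mu> {0..<a} - real m) / real N"
      using assms(2) by (simp add: field_simps)
    then show ?thesis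
      by simp
  qed
  moreover have "d / real N \<le> \<bar>real N * measure \<mu> {0..<a} - real m\<bar> / real N"
    using dist[of "int m"] by (simp add: divide_right_mono)
  ultimately show ?thesis
    by simp
qed

section \<open>Irrational masses\<close>

text \<open>Multiples of an irrational number have fractional parts dense in [0, 1]. A number within
  \<epsilon> of the midpoint between two consecutive integers is at least 1/2 - \<epsilon> away from
  every integer.\<close>

lemma exists_multiple_near_half_integer:
  fixes \<theta> :: real and L :: nat
  assumes "\<theta> \<notin> \<rat>" "\<epsilon> > 0" "L \<ge> 1"
  obtains N where "N \<ge> L" "\<And>k::int. 1/2 - \<epsilon> \<le> \<bar>real N * \<theta> - of_int k\<bar>"
proof -
  \<comment> \<open>Passing to \<open>L \<theta>\<close> makes every nonzero multiple an admissible \<open>N \<ge> L\<close>.\<close>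
  have "real L * \<theta> \<notin> \<rat>"
  proof
    assume "real L * \<theta> \<in> \<rat>"
    then have "(real L * \<theta>) / real L \<in> \<rat>"
      by (intro Rats_divide) auto
    then show False
      using assms by simp
  qed
  from Kronecker_approx_1_explicit[OF this, of "1/2" \<epsilon>] assms(2)
  obtain m :: nat where m: "m > 0" "\<bar>frac (real m * (real L * \<theta>)) - 1/2\<bar> < \<epsilon>"
    by auto
  define N where "N = m * L"
  define h where "h = \<lfloor>real N * \<theta>\<rfloor>"
  have h: "\<bar>real N * \<theta> - of_int h - 1/2\<bar> < \<epsilon>"
    using m(2) by (simp add: N_def h_def frac_def mult.assoc)
  have "1/2 - \<epsilon> \<le> \<bar>real N * \<theta> - of_int j\<bar>" for j :: int
  proof (cases "j \<le> h")
    case True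
    then have "real_of_int j \<le> of_int h"
      by simp
    then show ?thesis
      using h by linarith
  next
    case False
    then have "real_of_int j \<ge> of_int h + 1"
      by linarith
    then show ?thesis
      using h by linarith
  qed
  moreover have "N \<ge> L"
    using m(1) by (simp add: N_def)
  ultimately show thesis
    using that by blast
qed

lemma infinite_star_discrepancy_ge_of_irrational:
  assumes "prob_space \<mu>" "0 \<le> a" "a \<le> 1" "measure \<mu> {0..<a} \<notin> \<rat>" "c > 2"
  shows "infinite {N. N \<ge> 1 \<and> (\<forall>y. point_set N y \<longrightarrow>
           star_discrepancy \<mu> (empirical_measure N y) \<ge> 1 / (c * real N))}"
  unfolding infinite_nat_iff_unbounded_le
proof
  fix L :: nat
  \<comment> \<open>This is the tolerance that turns the distance bound into exactly 1/c; it is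
    positive because c > 2. Below, \<open>Suc L\<close> in place of \<open>L\<close> also ensures N
    \<ge> 1.\<close>
  have "1/2 - 1/c > 0"
    using assms(5) by (simp add: field_simps)
  then obtain N where N: "N \<ge> Suc L"
      "\<And>k::int. 1/2 - (1/2 - 1/c) \<le> \<bar>real N * measure \<mu> {0..<a} - of_int k\<bar>"
    using exists_multiple_near_half_integer[OF assms(4), of "1/2 - 1/c" "Suc L"] by auto
  have "1 / (c * real N) \<le> star_discrepancy \<mu> (empirical_measure N y)" for y
    using star_discrepancy_ge[OF assms(1) _ assms(2,3), of N "1/c" y] N by simp
  then show "\<exists>N\<ge>L. N \<in> {N. N \<ge> 1 \<and> (\<forall>y. point_set N y \<longrightarrow>
      star_discrepancy \<mu> (empirical_measure N y) \<ge> 1 / (c * real N))}"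
    using N(1) by (intro exI[of _ N]) auto
qed

section \<open>Rational masses\<close>

text \<open>The difference is a fraction t/q with an integer \<open>t\<close>. Were t = 0, then
  \<open>q\<close> would divide \<open>N * p\<close> and, by coprimality, \<open>N\<close>. The
  integer \<open>z\<close> will absorb the weights before the critical one.\<close>

lemma dist_int_add_fraction:
  fixes p q N :: nat and z :: real
  assumes "z \<in> \<int>" "coprime p q" "q \<ge> 1" "\<not> q dvd N"
  shows "1 / real q \<le> \<bar>z + real N * (real p / real q) - of_int k\<bar>"
proof (rule ccontr)
  assume neg: "\<not> ?thesis"
  obtain w where w: "z = of_int w"
    using assms(1) by (auto elim: Ints_cases)
  define t where "t = int q * (w - k) + int N * int p"
  have t: "z + real N * (real p / real q) - of_int k = of_int t / real q"
    using assms(3) by (simp add: t_def w field_simps)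
  then have "\<bar>real_of_int t\<bar> / real q < 1 / real q"
    using neg by (simp add: abs_divide)
  then have "\<bar>real_of_int t\<bar> < 1"
    using assms(3) by (simp add: divide_less_cancel)
  then have "t = 0"
    by linarith
  then have "int N * int p = int q * (k - w)"
    by (simp add: t_def algebra_simps)
  then have "int q dvd int (N * p)"
    by simp
  then have "q dvd N * p"
    by (simp only: int_dvd_int_iff)
  then show False
    using assms(2,4) by (simp add: coprime_commute coprime_dvd_mult_left_iff)
qed

lemma mult_fraction_in_Ints:
  fixes p q N :: nat
  assumes "q dvd N"
  shows "real N * (real p / real q) \<in> \<int>"
proof (cases "q = 0")
  case False
  from assms obtain r where "N = q * r" ..
  with False have "real N * (real p / real q) = real (r * p)"
    by simp
  then show ?thesis
    by (simp only: Ints_of_nat)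
qed simp

lemma infinite_star_discrepancy_ge_of_rational:
  assumes "prob_space \<mu>" "0 \<le> a" "a \<le> 1" "measure \<mu> {0..<a} \<in> \<rat>"
    and "0 < measure \<mu> {0..<a}" "measure \<mu> {0..<a} < 1"
  shows "\<exists>c\<ge>2. infinite {N. N \<ge> 1 \<and> (\<forall>y. point_set N y \<longrightarrow>
           star_discrepancy \<mu> (empirical_measure N y) \<ge> 1 / (c * real N))}"
proof -
  obtain p q :: nat where pq: "q \<noteq> 0" "\<bar>measure \<mu> {0..<a}\<bar> = real p / real q" "coprime p q"
    using Rats_abs_nat_div_natE[OF assms(4)] by metis
  \<comment> \<open>Denominator 1 would make the mass a natural number strictly between 0 and
    1.\<close>
  have "q \<noteq> 1"
  proof
    assume "q = 1"
    then show False
      using pq(2) assms(5,6) by simp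
  qed
  with pq(1) have "q \<ge> 2"
    by simp
  have "\<exists>N\<ge>L. N \<ge> 1 \<and> (\<forall>y. point_set N y \<longrightarrow>
      star_discrepancy \<mu> (empirical_measure N y) \<ge> 1 / (real q * real N))" for L
  proof -
    \<comment> \<open>The remainder 1 keeps \<open>q\<close> from dividing \<open>N\<close>, while
      the multiple of \<open>q\<close> carries \<open>N\<close> beyond \<open>L\<close>.\<close>
    define N where "N = L * q + 1"
    have "\<not> q dvd N"
      using \<open>q \<ge> 2\<close> unfolding N_def by (metis dvd_add_right_iff dvd_triv_right nat_dvd_1_iff_1 \<open>q \<noteq> 1\<close>)
    then have "1 / real q \<le> \<bar>real N * measure \<mu> {0..<a} - of_int k\<bar>" for k :: int
      using dist_int_add_fraction[of 0 p q N k] pq by simp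
    then have "1 / (real q * real N) \<le> star_discrepancy \<mu> (empirical_measure N y)" for y
      using star_discrepancy_ge[OF assms(1) _ assms(2,3), of N "1 / real q" y]
      by (simp add: N_def)
    moreover have "L * 1 \<le> L * q"
      using \<open>q \<ge> 2\<close> by (intro mult_le_mono2) simp
    then have "N \<ge> L" "N \<ge> 1"
      unfolding N_def by linarith+
    ultimately show ?thesis
      by blast
  qed
  then have "infinite {N. N \<ge> 1 \<and> (\<forall>y. point_set N y \<longrightarrow>
           star_discrepancy \<mu> (empirical_measure N y) \<ge> 1 / (real q * real N))}"
    unfolding infinite_nat_iff_unbounded_le by simp
  then show ?thesis
    using \<open>q \<ge> 2\<close> by (intro exI[of _ "real q"]) simp
qed

section \<open>Point sets with discrepancy zero\<close>

text \<open>This distributes \<open>N\<close> sample points over \<open>n\<close> atoms with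
  prescribed multiplicities: \<open>f k\<close> is the index of the atom that carries the
  \<open>k\<close>-th point.\<close>

lemma exists_map_with_fibre_cards:
  fixes m :: "nat \<Rightarrow> nat"
  assumes "sum m {1..n} = N"
  obtains f where "f ` {1..N} \<subseteq> {1..n}"
    and "\<And>J. J \<subseteq> {1..n} \<Longrightarrow> card {k\<in>{1..N}. f k \<in> J} = sum m J"
proof -
  \<comment> \<open>\<open>S\<close> holds \<open>m i\<close> tagged copies of each
    \<open>i\<close>; any bijection from the sample indices to \<open>S\<close>, followed by
    \<open>fst\<close>, has the right fibres.\<close>
  define S where "S = Sigma {1..n} (\<lambda>i. {..<m i})"
  have "finite S" "card S = card {1..N}"
    using assms by (simp_all add: S_def)
  then obtain h where h: "bij_betw h {1..N} S"
    using finite_same_card_bij[of "{1..N}" S] by auto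
  show thesis
  proof (rule that[of "fst \<circ> h"])
    show "(fst \<circ> h) ` {1..N} \<subseteq> {1..n}"
      using bij_betwE[OF h] by (auto simp: S_def)
    fix J assume J: "J \<subseteq> {1..n}"
    have "h ` {k\<in>{1..N}. (fst \<circ> h) k \<in> J} = {s\<in>S. fst s \<in> J}"
      using bij_betw_imp_surj_on[OF h] by force
    also have "\<dots> = Sigma J (\<lambda>i. {..<m i})"
      using J by (auto simp: S_def)
    finally have "card (h ` {k\<in>{1..N}. (fst \<circ> h) k \<in> J}) = sum m J"
      using finite_subset[OF J] by simp
    moreover have "inj_on h {k\<in>{1..N}. (fst \<circ> h) k \<in> J}"
      using bij_betw_imp_inj_on[OF h] by (rule inj_on_subset) auto
    ultimately show "card {k\<in>{1..N}. (fst \<circ> h) k \<in> J} = sum m J"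
      by (simp add: card_image)
  qed
qed

text \<open>Placing \<open>m i\<close> of the \<open>N\<close> points on the atom \<open>x i\<close>
  reproduces its weight exactly, so both measures agree on every anchored interval.\<close>

lemma exists_zero_star_discrepancy:
  assumes "prob_space \<mu>" "sets \<mu> = sets unit_borel" "is_dirac_sum \<mu> {1..n} \<xi> x"
    and x: "\<forall>i\<in>{1..n}. 0 \<le> x i \<and> x i \<le> 1"
    and m: "\<And>i. i \<in> {1..n} \<Longrightarrow> real N * \<xi> i = real (m i)" and "N \<ge> 1"
  shows "\<exists>y. point_set N y \<and> star_discrepancy \<mu> (empirical_measure N y) = 0"
proof -
  have "sum \<xi> {1..n} = 1"
    using is_dirac_sum_weights_sum[OF assms(1-3)] x by simp
  moreover have "real (sum m {1..n}) = real N * sum \<xi> {1..n}"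
    using m by (simp add: sum_distrib_left)
  ultimately have "sum m {1..n} = N"
    by (simp only: mult_1_right of_nat_eq_iff)
  then obtain f where f: "f ` {1..N} \<subseteq> {1..n}"
      "\<And>J. J \<subseteq> {1..n} \<Longrightarrow> card {k\<in>{1..N}. f k \<in> J} = sum m J"
    using exists_map_with_fibre_cards by metis
  have eq: "measure \<mu> A = measure (empirical_measure N (x \<circ> f)) A" if "A \<in> anchored_intervals" for A
  proof -
    have A: "A \<in> sets unit_borel"
      using that anchored_interval_in_sets unfolding anchored_intervals_def by blast
    define J where "J = {i\<in>{1..n}. x i \<in> A}"
    have "{k\<in>{1..N}. (x \<circ> f) k \<in> A} = {k\<in>{1..N}. f k \<in> J}"
      using f(1) by (fastforce simp: J_def)
    then have "real (card {k\<in>{1..N}. (x \<circ> f) k \<in> A}) = real (sum m J)"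
      using f(2)[of J] by (simp only: J_def Collect_restrict)
    also have "\<dots> = real N * sum \<xi> J"
      using m by (simp add: sum_distrib_left J_def)
    also have "sum \<xi> J = measure \<mu> A"
      by (rule is_dirac_sum_measure_eq[OF assms(3,2) A, symmetric]) (auto simp: J_def)
    finally show ?thesis
      using \<open>N \<ge> 1\<close> by (simp only: measure_empirical_measure[OF \<open>N \<ge> 1\<close> A]) simp
  qed
  \<comment> \<open>The supremum of the constant 0 is 0 only once the index family is known to be
    nonempty.\<close>
  have "{0..<0} \<in> anchored_intervals"
    unfolding anchored_intervals_def by (intro CollectI exI[of _ 0]) simp
  then have "anchored_intervals \<noteq> {}"
    by blast
  then have "star_discrepancy \<mu> (empirical_measure N (x \<circ> f)) = 0"
    unfolding star_discrepancy_def by (simp add: eq)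
  moreover have "point_set N (x \<circ> f)"
    using f(1) x by (auto simp: point_set_def)
  ultimately show ?thesis
    by blast
qed

section \<open>Partial sums of the weights as interval masses\<close>

lemma measure_below_next_atom:
  assumes "is_dirac_sum \<mu> {1..n} \<xi> x" "sets \<mu> = sets unit_borel"
    and "strict_mono_on {1..n} x" "\<forall>i\<in>{1..n}. 0 \<le> x i \<and> x i \<le> 1" "l \<in> {1..n-1}"
  shows "measure \<mu> {0..<x (Suc l)} = sum \<xi> {1..l}"
proof (rule is_dirac_sum_measure_eq[OF assms(1,2)])
  show "{0..<x (Suc l)} \<in> sets unit_borel"
    using assms(4,5) by (intro anchored_interval_in_sets) auto
  fix i assume "i \<in> {1..n}"
  moreover have "x i < x (Suc l) \<longleftrightarrow> i < Suc l"
    using assms(3,5) \<open>i \<in> {1..n}\<close> by (intro strict_mono_on_less[of "{1..n}"]) auto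
  ultimately show "x i \<in> {0..<x (Suc l)} \<longleftrightarrow> i \<in> {1..l}"
    using assms(4) by auto
qed (use assms(5) in auto)

lemma measure_below_next_atom_infinite:
  assumes "is_dirac_sum \<mu> {1..} \<xi> x" "sets \<mu> = sets unit_borel"
    and "\<forall>i\<ge>1. x i < x (i + 1)" "\<forall>i\<ge>1. 0 \<le> x i \<and> x i \<le> 1" "l \<ge> 1"
  shows "measure \<mu> {0..<x (Suc l)} = sum \<xi> {1..l}"
proof (rule is_dirac_sum_measure_eq[OF assms(1,2)])
  \<comment> \<open>The atoms are indexed from 1 and \<open>x 0\<close> is arbitrary; the shift
    gives a sequence that increases on all naturals.\<close>
  have "strict_mono (\<lambda>i. x (Suc i))"
    using assms(3) by (simp add: strict_mono_Suc_iff)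
  then have less: "x (Suc i) < x (Suc j) \<longleftrightarrow> i < j" for i j
    by (rule strict_mono_less)
  show "{0..<x (Suc l)} \<in> sets unit_borel"
    using assms(4) by (intro anchored_interval_in_sets) auto
  fix i :: nat assume "i \<in> {1..}"
  then show "x i \<in> {0..<x (Suc l)} \<longleftrightarrow> i \<in> {1..l}"
    using assms(4) less[of "i - 1" l] by auto
qed auto

section \<open>The dichotomy for rational weights\<close>

lemma star_discrepancy_ge_of_not_Lcm_dvd:
  assumes "prob_space \<mu>" "sets \<mu> = sets unit_borel" "is_dirac_sum \<mu> {1..n} \<xi> x"
    and "strict_mono_on {1..n} x" "\<forall>i\<in>{1..n}. 0 \<le> x i \<and> x i \<le> 1"
    and pq: "\<forall>i\<in>{1..n}. q i \<ge> 1 \<and> coprime (p i) (q i) \<and> \<xi> i = real (p i) / real (q i)"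
    and "N \<ge> 1" and ndvd: "\<not> Lcm (q ` {1..n-1}) dvd N"
  shows "1 / (real (Max (q ` {1..n})) * real N) \<le> star_discrepancy \<mu> (empirical_measure N y)"
proof -
  have "\<exists>i. i \<in> {1..n-1} \<and> \<not> q i dvd N"
    using ndvd Lcm_least[of "q ` {1..n-1}" N] by blast
  \<comment> \<open>Minimality of \<open>l\<close> makes all earlier terms
    \<open>N * \<xi> i\<close> integers, so only the \<open>l\<close>-th term moves the partial sum
    off the integers.\<close>
  then obtain l where l: "l \<in> {1..n-1}" "\<not> q l dvd N"
    and least: "\<And>i. i < l \<Longrightarrow> \<not> (i \<in> {1..n-1} \<and> \<not> q i dvd N)"
    using exists_least_iff[of "\<lambda>i. i \<in> {1..n-1} \<and> \<not> q i dvd N"] by blast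
  have ln: "l \<in> {1..n}"
    using l by auto
  have "real N * \<xi> i \<in> \<int>" if "i \<in> {1..<l}" for i
  proof -
    have "q i dvd N" "i \<in> {1..n}"
      using least[of i] that l by auto
    then show ?thesis
      using pq mult_fraction_in_Ints[of "q i" N "p i"] by simp
  qed
  then have "(\<Sum>i\<in>{1..<l}. real N * \<xi> i) \<in> \<int>"
    by (rule Ints_sum)
  moreover have "real N * sum \<xi> {1..l} = (\<Sum>i\<in>{1..<l}. real N * \<xi> i) + real N * \<xi> l"
  proof -
    have "{1..l} = insert l {1..<l}"
      using l(1) by auto
    then show ?thesis
      by (simp add: sum_distrib_left algebra_simps)
  qed
  ultimately have dist: "1 / real (q l) \<le> \<bar>real N * measure \<mu> {0..<x (Suc l)} - of_int k\<bar>" for k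
    using dist_int_add_fraction[of "\<Sum>i\<in>{1..<l}. real N * \<xi> i" "p l" "q l" N k] pq ln l(2)
      measure_below_next_atom[OF assms(3,2,4,5) l(1)] by auto
  have "Suc l \<in> {1..n}"
    using l(1) by auto
  then have "1 / real (q l) / real N \<le> star_discrepancy \<mu> (empirical_measure N y)"
    using star_discrepancy_ge[OF assms(1) \<open>N \<ge> 1\<close> _ _ dist] assms(5) by blast
  moreover have "1 / (real (Max (q ` {1..n})) * real N) \<le> 1 / (real (q l) * real N)"
  proof -
    have "q l \<le> Max (q ` {1..n})"
      using ln by (intro Max_ge) auto
    moreover have "q l \<ge> 1"
      using pq ln by blast
    ultimately show ?thesis
      using \<open>N \<ge> 1\<close> by (intro divide_left_mono mult_right_mono mult_pos_pos) auto
  qed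
  ultimately show ?thesis
    by simp
qed

text \<open>The least common multiple omits \<open>q n\<close>, but the weights sum to 1:
  \<open>N * \<xi> n\<close> is \<open>N\<close> minus a sum of integers, hence an integer as
  well.\<close>

lemma exists_zero_star_discrepancy_of_Lcm_dvd:
  assumes "prob_space \<mu>" "sets \<mu> = sets unit_borel" "is_dirac_sum \<mu> {1..n} \<xi> x"
    and x: "\<forall>i\<in>{1..n}. 0 \<le> x i \<and> x i \<le> 1"
    and pq: "\<forall>i\<in>{1..n}. q i \<ge> 1 \<and> coprime (p i) (q i) \<and> \<xi> i = real (p i) / real (q i)"
    and "N \<ge> 1" "n \<ge> 1" and dvd: "Lcm (q ` {1..n-1}) dvd N"
  shows "\<exists>y. point_set N y \<and> star_discrepancy \<mu> (empirical_measure N y) = 0"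
proof -
  have int: "real N * \<xi> i \<in> \<int>" if "i \<in> {1..n-1}" for i
  proof -
    have "q i dvd N" "i \<in> {1..n}"
      using dvd that by (auto intro: dvd_trans[OF dvd_Lcm])
    then show ?thesis
      using pq mult_fraction_in_Ints[of "q i" N "p i"] by simp
  qed
  have "sum \<xi> {1..n} = 1"
    using is_dirac_sum_weights_sum[OF assms(1-3)] x by simp
  moreover have "{1..n} = insert n {1..n-1}" "n \<notin> {1..n-1}"
    using \<open>n \<ge> 1\<close> by auto
  ultimately have "\<xi> n = 1 - sum \<xi> {1..n-1}"
    by simp
  then have "real N * \<xi> n = real N - (\<Sum>i\<in>{1..n-1}. real N * \<xi> i)"
    by (simp add: right_diff_distrib flip: sum_distrib_left)
  also have "\<dots> \<in> \<int>"
    using int by (intro Ints_diff Ints_sum) auto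
  finally have "real N * \<xi> n \<in> \<int>" .
  then have "real N * \<xi> i \<in> \<int>" if "i \<in> {1..n}" for i
    using int that by (cases "i = n") auto
  \<comment> \<open>The weights are quotients of naturals, hence nonnegative, so \<open>nat\<close>
    loses nothing.\<close>
  then have "real N * \<xi> i = real (nat \<lfloor>real N * \<xi> i\<rfloor>)" if "i \<in> {1..n}" for i
    using that pq by simp
  then show ?thesis
    by (rule exists_zero_star_discrepancy[OF assms(1-4) _ \<open>N \<ge> 1\<close>])
qed

section \<open>Assembly of the three statements\<close>

theorem theorem1p2:
  fixes \<mu> :: "real measure"
  assumes "prob_space \<mu>" and "sets \<mu> = sets unit_borel" and "discrete_measure \<mu>"
  shows
    "(\<forall>(n::nat) (\<xi>::nat \<Rightarrow> real) (x::nat \<Rightarrow> real) (p::nat \<Rightarrow> nat) (q::nat \<Rightarrow> nat) (N::nat).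
        n \<ge> 1 \<and> N \<ge> 1 \<and>
        is_dirac_sum \<mu> {1..n} \<xi> x \<and>
        strict_mono_on {1..n} x \<and> (\<forall>i\<in>{1..n}. 0 \<le> x i \<and> x i \<le> 1) \<and>
        (\<forall>i\<in>{1..n}. q i \<ge> 1 \<and> coprime (p i) (q i) \<and> \<xi> i = real (p i) / real (q i))
        \<longrightarrow>
        (Lcm (q ` {1..n-1}) dvd N \<longrightarrow>
           (\<exists>y. point_set N y \<and> star_discrepancy \<mu> (empirical_measure N y) = 0)) \<and>
        (\<not> Lcm (q ` {1..n-1}) dvd N \<longrightarrow>
           (\<forall>y. point_set N y \<longrightarrow>
              star_discrepancy \<mu> (empirical_measure N y)
                \<ge> 1 / (real (Max (q ` {1..n})) * real N))))
     \<and>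
     (\<forall>(n::nat) (\<xi>::nat \<Rightarrow> real) (x::nat \<Rightarrow> real).
        n \<ge> 1 \<and>
        is_dirac_sum \<mu> {1..n} \<xi> x \<and>
        strict_mono_on {1..n} x \<and> (\<forall>i\<in>{1..n}. 0 \<le> x i \<and> x i \<le> 1) \<and>
        (\<forall>i\<in>{1..n}. \<xi> i \<notin> \<rat>) \<and>
        (\<forall>l\<in>{1..n-1}. (\<Sum>i=1..l. \<xi> i) \<notin> \<rat>)
        \<longrightarrow>
        (\<forall>c>2. infinite {N. N \<ge> 1 \<and>
           (\<forall>y. point_set N y \<longrightarrow>
              star_discrepancy \<mu> (empirical_measure N y) \<ge> 1 / (c * real N))}))
     \<and>
     (\<forall>(\<xi>::nat \<Rightarrow> real) (x::nat \<Rightarrow> real).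
        is_dirac_sum \<mu> {1..} \<xi> x \<and>
        (\<forall>i\<ge>1. 0 \<le> x i \<and> x i \<le> 1) \<and>
        (\<forall>i\<ge>1. x i < x (i + 1)) \<and> (\<forall>i\<ge>1. \<xi> i > 0)
        \<longrightarrow>
        (\<exists>c\<ge>2. infinite {N. N \<ge> 1 \<and>
           (\<forall>y. point_set N y \<longrightarrow>
              star_discrepancy \<mu> (empirical_measure N y) \<ge> 1 / (c * real N))}) \<and>
        ((\<forall>l\<ge>1. (\<Sum>i=1..l. \<xi> i) \<notin> \<rat>) \<longrightarrow>
           (\<forall>c>2. infinite {N. N \<ge> 1 \<and>
              (\<forall>y. point_set N y \<longrightarrow>
                 star_discrepancy \<mu> (empirical_measure N y) \<ge> 1 / (c * real N))})))"
proof (intro conjI allI impI, goal_cases)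
  case (1 n \<xi> x p q N)
  then show ?case
    using exists_zero_star_discrepancy_of_Lcm_dvd[OF assms(1,2)] by blast
next
  case (2 n \<xi> x p q N y)
  then show ?case
    using star_discrepancy_ge_of_not_Lcm_dvd[OF assms(1,2)] by blast
next
  case (3 n \<xi> x c)
  have "sum \<xi> {1..n} = 1"
    using is_dirac_sum_weights_sum[OF assms(1,2)] 3 by (meson finite_atLeastAtMost)
  \<comment> \<open>A single atom would have the rational weight 1; hence a second atom exists to
    end the interval.\<close>
  then have "n \<noteq> 1"
    using 3 by auto
  with 3 have one: "1 \<in> {1..n-1}" and two: "Suc 1 \<in> {1..n}"
    by auto
  have "measure \<mu> {0..<x (Suc 1)} = sum \<xi> {1..1}"
    using 3 one assms(2) by (intro measure_below_next_atom) auto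
  then have "measure \<mu> {0..<x (Suc 1)} \<notin> \<rat>"
    using 3 one by metis
  moreover have "0 \<le> x (Suc 1)" "x (Suc 1) \<le> 1"
    using 3 two by blast+
  ultimately show ?case
    using infinite_star_discrepancy_ge_of_irrational[OF assms(1)] 3 by blast
next
  case (4 \<xi> x)
  interpret prob_space \<mu> by fact
  have mass: "measure \<mu> {0..<x (Suc l)} = sum \<xi> {1..l}" if "l \<ge> 1" for l
    using 4 assms(2) that by (intro measure_below_next_atom_infinite) auto
  have x2: "0 \<le> x (Suc 1)" "x (Suc 1) \<le> 1"
    using 4 by auto
  have pos: "\<xi> 1 > 0" "\<xi> 2 > 0"
    using 4 by auto
  \<comment> \<open>As the second weight is positive, this forces the first below 1, which excludes
    denominator 1 in the rational case.\<close>
  have "\<xi> 1 + \<xi> 2 \<le> 1"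
    using mass[of 2] prob_le_1[of "{0..<x (Suc 2)}"] by (simp add: numeral_2_eq_2)
  then have bounds: "0 < measure \<mu> {0..<x (Suc 1)}" "measure \<mu> {0..<x (Suc 1)} < 1"
    using mass[of 1] pos by auto
  show ?case
  proof (cases "measure \<mu> {0..<x (Suc 1)} \<in> \<rat>")
    case True
    then show ?thesis
      using infinite_star_discrepancy_ge_of_rational[OF assms(1) x2] bounds by blast
  \<comment> \<open>For an irrational first weight any constant above 2 would do; 3 is a sample
    choice.\<close>
  next
    case False
    then show ?thesis
      using infinite_star_discrepancy_ge_of_irrational[OF assms(1) x2, of 3]
      by (intro exI[of _ 3]) simp
  qed
next
  case (5 \<xi> x c)
  have "measure \<mu> {0..<x (Suc 1)} = sum \<xi> {1..1}"
    using 5 assms(2) by (intro measure_below_next_atom_infinite) auto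
  then have "measure \<mu> {0..<x (Suc 1)} \<notin> \<rat>"
    using 5 by (metis order_refl)
  moreover have "0 \<le> x (Suc 1)" "x (Suc 1) \<le> 1"
    using 5 by auto
  ultimately show ?case
    using infinite_star_discrepancy_ge_of_irrational[OF assms(1)] 5 by blast
qed

end
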